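(* Let $(X,d)$ be a complete $b$-metric space with coefficient $s \geq 1$ and let $E$ be a nonempty closed subset of $X$. Let $\mathfrak{F}$ be a nonempty set of mappings $f:\mathbb{N}_0\to\mathbb{N}_0$ with the shift property: if $f\in\mathfrak{F}$ and $p\in\mathbb{N}$, then $f_p\in\mathfrak{F}$, where $f_p(i)=f(i+p)$ for all $i\in\mathbb{N}_0$. For each $i\in\mathbb{N}_0$ let $T_i:X\to X$ be a weak quasi-contraction such that $T_i(E)\subset E$, and suppose that $$\operatorname{diam}\mathcal{O}_{T_{f(j)}}(T_{f(i)}x,T_{f(i)}y)\leq \operatorname{diam}\mathcal{O}_{T_{f(j)}}(x,y)\quad\text{for all } x,y\in X,\ f\in\mathfrak{F},\ i,j\in\mathbb{N}_0.$$ Suppose that for each $\epsilon>0$ there exists a natural number $n_\epsilon$ such that for each $f\in\mathfrak{F}$ and each $x\in X$, $$d(T_{f(n_\epsilon)}T_{f(n_\epsilon-1)}\cdots T_{f(1)}T_{f(0)}x,\,E)<\epsilon.$$ Let $\{\delta_i\}_{i=0}^\infty$ be a sequence of positive numbers with $\lim_{i\to\infty}\delta_i=0$. Then for each $\epsilon>0$ there exists $\overline{n}\in\mathbb{N}$ such that for each $f\in\mathfrak{F}$ and each sequence $\{x_i\}_{i=0}^\infty\subset X$ satisfying $$\operatorname{diam}\mathcal{O}_{T_{f(j)}}(x_{i+1},T_{f(i)}x_i)\leq\delta_i\quad\text{for all } i,j\in\mathbb{N}_0,$$ one has $d(x_i,E)<\epsilon$ for all $i\geq\overline{n}$.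
   Context: $\mathbb{N}$ is the set of natural numbers (positive integers) and $\mathbb{N}_0=\mathbb{N}\cup\{0\}$. A $b$-metric space with coefficient $s\geq1$ is a nonempty set $X$ with $d:X\times X\to[0,\infty)$ such that for all $x,y,z\in X$: $d(x,y)=0$ iff $x=y$; $d(x,y)=d(y,x)$; $d(x,y)\leq s[d(x,z)+d(z,y)]$. A sequence $\{x_n\}$ converges to $x$ iff $d(x_n,x)\to0$; it is Cauchy iff $d(x_n,x_m)\to0$ as $n,m\to\infty$; $(X,d)$ is complete if every Cauchy sequence converges in $X$. For nonempty $A\subset X$, $d(x,A)=\inf\{d(x,y):y\in A\}$. For $T:X\to X$: $T^0$ is the identity, $T^{n+1}=T\circ T^n$, $\mathcal{O}_T(x)=\{T^nx:n\in\mathbb{N}_0\}$, $\mathcal{O}_T(x,y)=\mathcal{O}_T(x)\cup\mathcal{O}_T(y)$; $\operatorname{diam}A=\sup\{d(u,v):u,v\in A\}$. $T$ is a weak quasi-contraction if every orbit $\mathcal{O}_T(x)$ is bounded and $d(Tx,Ty)\leq\psi(\operatorname{diam}\mathcal{O}_T(x,y))$ for all $x,y\in X$, for some $\psi:[0,\infty)\to[0,\infty)$ that is increasing and upper semi-continuous with $\psi(0)=0$ and $\psi(t)<t$ for all $t>0$. *)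

theory Defs
  imports "HOL-Analysis.Analysis"
begin

definition b_metric_space :: "'a set \<Rightarrow> ('a \<Rightarrow> 'a \<Rightarrow> real) \<Rightarrow> real \<Rightarrow> bool" where
  "b_metric_space X d s \<longleftrightarrow>
     X \<noteq> {} \<and> 1 \<le> s \<and>
     (\<forall>x\<in>X. \<forall>y\<in>X. 0 \<le> d x y) \<and>
     (\<forall>x\<in>X. \<forall>y\<in>X. d x y = 0 \<longleftrightarrow> x = y) \<and>
     (\<forall>x\<in>X. \<forall>y\<in>X. d x y = d y x) \<and>
     (\<forall>x\<in>X. \<forall>y\<in>X. \<forall>z\<in>X. d x y \<le> s * (d x z + d z y))"

definition b_converges :: "('a \<Rightarrow> 'a \<Rightarrow> real) \<Rightarrow> (nat \<Rightarrow> 'a) \<Rightarrow> 'a \<Rightarrow> bool" where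
  "b_converges d x l \<longleftrightarrow> (\<lambda>n. d (x n) l) \<longlonglongrightarrow> 0"

definition b_Cauchy :: "('a \<Rightarrow> 'a \<Rightarrow> real) \<Rightarrow> (nat \<Rightarrow> 'a) \<Rightarrow> bool" where
  "b_Cauchy d x \<longleftrightarrow> (\<forall>\<epsilon>>0. \<exists>N. \<forall>n\<ge>N. \<forall>m\<ge>N. d (x n) (x m) < \<epsilon>)"

definition b_complete :: "'a set \<Rightarrow> ('a \<Rightarrow> 'a \<Rightarrow> real) \<Rightarrow> bool" where
  "b_complete X d \<longleftrightarrow>
     (\<forall>x. (\<forall>n. x n \<in> X) \<and> b_Cauchy d x \<longrightarrow> (\<exists>l\<in>X. b_converges d x l))"

text \<open>Balls of a b-metric need not be open, so closedness is expressed by sequences; this agrees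
  with closedness in the topology whose open sets contain a ball around each of their points.\<close>

definition b_closed :: "'a set \<Rightarrow> ('a \<Rightarrow> 'a \<Rightarrow> real) \<Rightarrow> 'a set \<Rightarrow> bool" where
  "b_closed X d E \<longleftrightarrow>
     E \<subseteq> X \<and> (\<forall>x l. (\<forall>n. x n \<in> E) \<and> l \<in> X \<and> b_converges d x l \<longrightarrow> l \<in> E)"

definition b_bounded :: "('a \<Rightarrow> 'a \<Rightarrow> real) \<Rightarrow> 'a set \<Rightarrow> bool" where
  "b_bounded d A \<longleftrightarrow> (\<exists>M. \<forall>u\<in>A. \<forall>v\<in>A. d u v \<le> M)"

text \<open>The supremum is a genuine one only for nonempty bounded sets; by the boundedness lemma below
  this covers every diameter attached to a weak quasi-contraction.\<close>

definition b_diam :: "('a \<Rightarrow> 'a \<Rightarrow> real) \<Rightarrow> 'a set \<Rightarrow> real" where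
  "b_diam d A = (SUP (u, v)\<in>A \<times> A. d u v)"

definition b_setdist :: "('a \<Rightarrow> 'a \<Rightarrow> real) \<Rightarrow> 'a \<Rightarrow> 'a set \<Rightarrow> real" where
  "b_setdist d x A = (INF y\<in>A. d x y)"

definition orb :: "('a \<Rightarrow> 'a) \<Rightarrow> 'a \<Rightarrow> 'a set" where
  "orb T x = {(T ^^ n) x | n. True}"

definition orb2 :: "('a \<Rightarrow> 'a) \<Rightarrow> 'a \<Rightarrow> 'a \<Rightarrow> 'a set" where
  "orb2 T x y = orb T x \<union> orb T y"

definition upper_semicontinuous_on :: "real set \<Rightarrow> (real \<Rightarrow> real) \<Rightarrow> bool" where
  "upper_semicontinuous_on A \<psi> \<longleftrightarrow>
     (\<forall>t\<in>A. \<forall>c>\<psi> t. eventually (\<lambda>u. \<psi> u < c) (at t within A))"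

definition weak_quasi_contraction ::
  "'a set \<Rightarrow> ('a \<Rightarrow> 'a \<Rightarrow> real) \<Rightarrow> ('a \<Rightarrow> 'a) \<Rightarrow> bool" where
  "weak_quasi_contraction X d T \<longleftrightarrow>
     T \<in> X \<rightarrow> X \<and>
     (\<forall>x\<in>X. b_bounded d (orb T x)) \<and>
     (\<exists>\<psi>. \<psi> \<in> {0..} \<rightarrow> {0..} \<and> mono_on {0..} \<psi> \<and> upper_semicontinuous_on {0..} \<psi> \<and>
          \<psi> 0 = 0 \<and> (\<forall>t>0. \<psi> t < t) \<and>
          (\<forall>x\<in>X. \<forall>y\<in>X. d (T x) (T y) \<le> \<psi> (b_diam d (orb2 T x y))))"

text \<open>\<open>seq_comp T f n x\<close> is T_f(n) ... T_f(1) T_f(0) x.\<close>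

primrec seq_comp :: "(nat \<Rightarrow> 'a \<Rightarrow> 'a) \<Rightarrow> (nat \<Rightarrow> nat) \<Rightarrow> nat \<Rightarrow> 'a \<Rightarrow> 'a" where
  "seq_comp T f 0 x = T (f 0) x"
| "seq_comp T f (Suc n) x = T (f (Suc n)) (seq_comp T f n x)"

definition shift_property :: "(nat \<Rightarrow> nat) set \<Rightarrow> bool" where
  "shift_property F \<longleftrightarrow> (\<forall>f\<in>F. \<forall>p\<ge>1. (\<lambda>i. f (i + p)) \<in> F)"

lemma orb_subset:
  assumes "T \<in> X \<rightarrow> X" "x \<in> X"
  shows "orb T x \<subseteq> X"
proof -
  have "(T ^^ n) x \<in> X" for n
    using assms by (induction n) auto
  then show ?thesis by (auto simp: orb_def)
qed

lemma orb_self: "x \<in> orb T x"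
  unfolding orb_def by (rule CollectI, rule exI[of _ 0]) simp

lemma weak_quasi_contraction_bounded_orb2:
  assumes X: "b_metric_space X d s" and T: "weak_quasi_contraction X d T"
    and x: "x \<in> X" and y: "y \<in> X"
  shows "b_bounded d (orb2 T x y)"
proof -
  have TX: "T \<in> X \<rightarrow> X" and bd: "\<And>z. z \<in> X \<Longrightarrow> b_bounded d (orb T z)"
    using T by (auto simp: weak_quasi_contraction_def)
  have s: "1 \<le> s"
    using X unfolding b_metric_space_def by simp
  have sym: "d u v = d v u" if "u \<in> X" "v \<in> X" for u v
    using X that unfolding b_metric_space_def by metis
  have tri: "d u v \<le> s * (d u w + d w v)" if "u \<in> X" "v \<in> X" "w \<in> X" for u v w
    using X that unfolding b_metric_space_def by metis
  obtain M where M: "\<And>u v. u \<in> orb T x \<Longrightarrow> v \<in> orb T x \<Longrightarrow> d u v \<le> M"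
    using bd[OF x] unfolding b_bounded_def by blast
  obtain N where N: "\<And>u v. u \<in> orb T y \<Longrightarrow> v \<in> orb T y \<Longrightarrow> d u v \<le> N"
    using bd[OF y] unfolding b_bounded_def by blast
  define B where "B = s * (M + s * (d x y + N))"
  have sub: "orb T x \<subseteq> X" "orb T y \<subseteq> X"
    using orb_subset[OF TX] x y by auto
  have cross: "d u v \<le> B" if u: "u \<in> orb T x" and v: "v \<in> orb T y" for u v
  proof -
    have uX: "u \<in> X" and vX: "v \<in> X" using u v sub by auto
    have "d x v \<le> s * (d x y + d y v)" using tri x y vX by blast
    also have "\<dots> \<le> s * (d x y + N)" using N[OF orb_self v] s by simp
    finally have 1: "d x v \<le> s * (d x y + N)" .
    have "d u v \<le> s * (d u x + d x v)" using tri x uX vX by blast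
    also have "\<dots> \<le> B"
      unfolding B_def using M[OF u orb_self] 1 s by (intro mult_left_mono add_mono) auto
    finally show ?thesis .
  qed
  have "d u v \<le> max B (max M N)" if "u \<in> orb2 T x y" "v \<in> orb2 T x y" for u v
  proof -
    consider "u \<in> orb T x" "v \<in> orb T x" | "u \<in> orb T y" "v \<in> orb T y"
      | "u \<in> orb T x" "v \<in> orb T y" | "u \<in> orb T y" "v \<in> orb T x"
      using \<open>u \<in> orb2 T x y\<close> \<open>v \<in> orb2 T x y\<close> unfolding orb2_def by blast
    then show ?thesis
    proof cases
      case 1 then show ?thesis using M[of u v] by simp
    next
      case 2 then show ?thesis using N[of u v] by simp
    next
      case 3 then show ?thesis using cross[of u v] by simp
    next
      case 4
      then have "d u v = d v u" using sym sub by blast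
      then show ?thesis using 4 cross[of v u] by simp
    qed
  qed
  then show ?thesis unfolding b_bounded_def by blast
qed

end

theory Submission
  imports Defs
begin

text \<open>Restart the exact iteration from a late term of the inexact orbit. Because the hypothesis on
  diameters makes the maps nonexpansive for the joint-orbit diameter, and because that diameter
  satisfies the b-triangle inequality, after n + 1 steps the two orbits differ by at most
  (2 s)^n times the largest error made since the restart. The number n of steps needed to bring
  the exact iterate close to E does not depend on the restart point, so the errors can be made
  small afterwards.\<close>

text \<open>Boundedness makes the real supremum an actual upper bound; on an unbounded set
  \<open>SUP\<close> carries no such information.\<close>

lemma dist_le_b_diam:
  assumes "b_bounded d A" "u \<in> A" "v \<in> A"
  shows "d u v \<le> b_diam d A"
proof -
  obtain M where "\<forall>u\<in>A. \<forall>v\<in>A. d u v \<le> M"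
    using assms(1) unfolding b_bounded_def by blast
  then have "bdd_above ((\<lambda>(u, v). d u v) ` (A \<times> A))"
    by (intro bdd_aboveI2[of _ _ M]) auto
  then have "(\<lambda>(u, v). d u v) (u, v) \<le> b_diam d A"
    unfolding b_diam_def by (rule cSUP_upper[rotated]) (use assms in auto)
  then show ?thesis by simp
qed

lemma b_diam_le:
  assumes "A \<noteq> {}" "\<And>u v. u \<in> A \<Longrightarrow> v \<in> A \<Longrightarrow> d u v \<le> M"
  shows "b_diam d A \<le> M"
  unfolding b_diam_def using assms by (intro cSUP_least) auto

text \<open>The infimum need not be attained, but a strict bound on it still leaves room for a point
  of \<open>E\<close>.\<close>

lemma b_setdist_lessE:
  assumes "b_setdist d x E < \<epsilon>" "E \<noteq> {}"
  obtains e where "e \<in> E" "d x e < \<epsilon>"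
  using assms cInf_lessD[of "d x ` E" \<epsilon>] unfolding b_setdist_def by auto

lemma b_metric_spaceD:
  assumes "b_metric_space X d s"
  shows "1 \<le> s"
    and "\<And>x y. x \<in> X \<Longrightarrow> y \<in> X \<Longrightarrow> 0 \<le> d x y"
    and "\<And>x y. x \<in> X \<Longrightarrow> y \<in> X \<Longrightarrow> d x y = d y x"
    and "\<And>x y z. x \<in> X \<Longrightarrow> y \<in> X \<Longrightarrow> z \<in> X \<Longrightarrow> d x y \<le> s * (d x z + d z y)"
proof -
  note * = assms[unfolded b_metric_space_def, THEN conjunct2]
  show "1 \<le> s" using * by (rule conjunct1)
  have nonneg: "\<forall>x\<in>X. \<forall>y\<in>X. 0 \<le> d x y"
    using * by (elim conjE)
  have sym: "\<forall>x\<in>X. \<forall>y\<in>X. d x y = d y x"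
    using * by (elim conjE)
  have tri: "\<forall>x\<in>X. \<forall>y\<in>X. \<forall>z\<in>X. d x y \<le> s * (d x z + d z y)"
    using * by (elim conjE)
  show "0 \<le> d x y" if "x \<in> X" "y \<in> X" for x y using nonneg that by blast
  show "d x y = d y x" if "x \<in> X" "y \<in> X" for x y using sym that by blast
  show "d x y \<le> s * (d x z + d z y)" if "x \<in> X" "y \<in> X" "z \<in> X" for x y z
    using tri that by blast
qed

lemma weak_quasi_contractionD: "weak_quasi_contraction X d T \<Longrightarrow> T \<in> X \<rightarrow> X"
  unfolding weak_quasi_contraction_def by (rule conjunct1)

lemma b_setdist_le:
  assumes "b_metric_space X d s" "E \<subseteq> X" "x \<in> X" "e \<in> E"
  shows "b_setdist d x E \<le> d x e"
  unfolding b_setdist_def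
proof (rule cINF_lower[OF _ assms(4)])
  show "bdd_below (d x ` E)"
    using b_metric_spaceD(2)[OF assms(1,3)] assms(2) by (intro bdd_belowI2[of _ 0]) blast
qed

text \<open>A point of the orbit of \<open>a\<close> and one of the orbit of \<open>c\<close> are
  joined through \<open>b\<close> itself, which lies in both joint orbits; two points of the same
  orbit are already controlled by one of the two diameters.\<close>

lemma b_diam_orb2_triangle:
  assumes X: "b_metric_space X d s" and T: "weak_quasi_contraction X d T"
    and a: "a \<in> X" and b: "b \<in> X" and c: "c \<in> X"
  shows "b_diam d (orb2 T a c) \<le> s * (b_diam d (orb2 T a b) + b_diam d (orb2 T b c))"
    (is "_ \<le> s * (?P + ?Q)")
proof -
  note s = b_metric_spaceD(1)[OF X] and nonneg = b_metric_spaceD(2)[OF X]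
    and sym = b_metric_spaceD(3)[OF X] and tri = b_metric_spaceD(4)[OF X]
  have P: "d u v \<le> ?P" if "u \<in> orb2 T a b" "v \<in> orb2 T a b" for u v
    using dist_le_b_diam[OF weak_quasi_contraction_bounded_orb2[OF X T a b] that] .
  have Q: "d u v \<le> ?Q" if "u \<in> orb2 T b c" "v \<in> orb2 T b c" for u v
    using dist_le_b_diam[OF weak_quasi_contraction_bounded_orb2[OF X T b c] that] .
  have sub: "orb T z \<subseteq> X" if "z \<in> X" for z
    by (rule orb_subset[OF weak_quasi_contractionD[OF T] that])
  have bP: "b \<in> orb2 T a b" and bQ: "b \<in> orb2 T b c"
    by (auto simp: orb2_def orb_self)
  have P0: "0 \<le> ?P" and Q0: "0 \<le> ?Q"
    using P[OF bP bP] Q[OF bQ bQ] nonneg[OF b b] by auto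
  \<comment> \<open>Needed for pairs inside one orbit, whose bound comes without the factor
    \<open>s\<close>.\<close>
  have sum: "?P + ?Q \<le> s * (?P + ?Q)"
    using mult_right_mono[OF s, of "?P + ?Q"] P0 Q0 by simp
  have cross: "d u v \<le> s * (?P + ?Q)" if u: "u \<in> orb T a" and v: "v \<in> orb T c" for u v
  proof -
    have "d u v \<le> s * (d u b + d b v)"
      using tri u v sub a b c by blast
    also have "\<dots> \<le> s * (?P + ?Q)"
      using P[OF _ bP, of u] Q[OF bQ, of v] u v s
      by (intro mult_left_mono add_mono) (auto simp: orb2_def)
    finally show ?thesis .
  qed
  show ?thesis
  proof (rule b_diam_le)
    show "orb2 T a c \<noteq> {}" using orb_self[of a T] unfolding orb2_def by blast
  next
    fix u v assume "u \<in> orb2 T a c" "v \<in> orb2 T a c"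
    then consider "u \<in> orb T a" "v \<in> orb T a" | "u \<in> orb T c" "v \<in> orb T c"
      | "u \<in> orb T a" "v \<in> orb T c" | "u \<in> orb T c" "v \<in> orb T a"
      unfolding orb2_def by blast
    then show "d u v \<le> s * (?P + ?Q)"
    proof cases
      case 1
      then have "d u v \<le> ?P" by (intro P) (auto simp: orb2_def)
      then show ?thesis using sum Q0 by linarith
    next
      case 2
      then have "d u v \<le> ?Q" by (intro Q) (auto simp: orb2_def)
      then show ?thesis using sum P0 by linarith
    next
      case 3 then show ?thesis by (rule cross)
    next
      case 4
      then have "d u v = d v u" using sym sub a c by blast
      then show ?thesis using cross 4 by simp
    qed
  qed
qed

lemma seq_comp_in_carrier:
  assumes "\<And>i. T i \<in> X \<rightarrow> X" "x \<in> X"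
  shows "seq_comp T f n x \<in> X"
  using assms by (induction n) auto

text \<open>The recursion starts at the first step and not at \<open>x 0\<close>, since the diameter of
  \<open>orb2 T (x 0) (x 0)\<close> is the diameter of a whole orbit and is not small.\<close>

lemma b_diam_orb2_inexact_le:
  assumes X: "b_metric_space X d s" and T: "\<And>i. weak_quasi_contraction X d (T i)"
    and nonexp: "\<And>u v i j. u \<in> X \<Longrightarrow> v \<in> X \<Longrightarrow>
           b_diam d (orb2 (T (f j)) (T (f i) u) (T (f i) v)) \<le> b_diam d (orb2 (T (f j)) u v)"
    and x: "\<And>i. x i \<in> X"
    and err: "\<And>i j. b_diam d (orb2 (T (f j)) (x (Suc i)) (T (f i) (x i))) \<le> \<eta>"
    and "0 \<le> \<eta>"
  shows "b_diam d (orb2 (T (f j)) (x (Suc n)) (seq_comp T f n (x 0))) \<le> (2 * s) ^ n * \<eta>"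
proof (induction n)
  case 0
  then show ?case using err[of j 0] by simp
next
  case (Suc n)
  note s = b_metric_spaceD(1)[OF X]
  note TX = weak_quasi_contractionD[OF T]
  let ?y = "seq_comp T f n (x 0)"
  have y: "?y \<in> X" using TX x by (intro seq_comp_in_carrier) blast+
  \<comment> \<open>The fresh error is absorbed into the bound for the accumulated one. Their sum
    costs a factor 2 and the b-triangle inequality a factor \<open>s\<close>, hence
    \<open>2 * s\<close> per step.\<close>
  have "1 * \<eta> \<le> (2 * s) ^ n * \<eta>"
    using s \<open>0 \<le> \<eta>\<close> by (intro mult_right_mono one_le_power) auto
  moreover have "b_diam d (orb2 (T (f j)) (T (f (Suc n)) (x (Suc n))) (T (f (Suc n)) ?y))
      \<le> (2 * s) ^ n * \<eta>"
    using nonexp[OF x y] Suc.IH by (rule order_trans)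
  ultimately have sum: "b_diam d (orb2 (T (f j)) (x (Suc (Suc n))) (T (f (Suc n)) (x (Suc n)))) +
      b_diam d (orb2 (T (f j)) (T (f (Suc n)) (x (Suc n))) (T (f (Suc n)) ?y))
      \<le> 2 * ((2 * s) ^ n * \<eta>)"
    using err[of j "Suc n"] by linarith
  have "b_diam d (orb2 (T (f j)) (x (Suc (Suc n))) (T (f (Suc n)) ?y)) \<le>
     s * (b_diam d (orb2 (T (f j)) (x (Suc (Suc n))) (T (f (Suc n)) (x (Suc n)))) +
      b_diam d (orb2 (T (f j)) (T (f (Suc n)) (x (Suc n))) (T (f (Suc n)) ?y)))"
    using TX x y by (intro b_diam_orb2_triangle[OF X T]) auto
  also have "\<dots> \<le> s * (2 * ((2 * s) ^ n * \<eta>))"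
    using sum s by (intro mult_left_mono) auto
  finally show ?case by (simp add: mult_ac)
qed

theorem theorem2p2:
  fixes X :: "'a set" and d :: "'a \<Rightarrow> 'a \<Rightarrow> real" and s :: real
    and E :: "'a set" and F :: "(nat \<Rightarrow> nat) set"
    and T :: "nat \<Rightarrow> 'a \<Rightarrow> 'a" and \<delta> :: "nat \<Rightarrow> real"
  assumes "b_metric_space X d s" and "b_complete X d"
    and "E \<noteq> {}" and "b_closed X d E"
    and "F \<noteq> {}" and "shift_property F"
    and "\<And>i. weak_quasi_contraction X d (T i)"
    and "\<And>i. T i ` E \<subseteq> E"
    and "\<And>x y f i j. x \<in> X \<Longrightarrow> y \<in> X \<Longrightarrow> f \<in> F \<Longrightarrow>
           b_diam d (orb2 (T (f j)) (T (f i) x) (T (f i) y)) \<le> b_diam d (orb2 (T (f j)) x y)"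
    and "\<And>\<epsilon>::real. \<epsilon> > 0 \<Longrightarrow>
           \<exists>n\<ge>1. \<forall>f\<in>F. \<forall>x\<in>X. b_setdist d (seq_comp T f n x) E < \<epsilon>"
    and "\<And>i. \<delta> i > 0" and "\<delta> \<longlonglongrightarrow> 0"
  shows "\<forall>\<epsilon>>0. \<exists>N\<ge>1. \<forall>f\<in>F. \<forall>x :: nat \<Rightarrow> 'a.
           (\<forall>i. x i \<in> X) \<and>
           (\<forall>i j. b_diam d (orb2 (T (f j)) (x (i + 1)) (T (f i) (x i))) \<le> \<delta> i)
           \<longrightarrow> (\<forall>i\<ge>N. b_setdist d (x i) E < \<epsilon>)"
proof (intro allI impI)
  fix \<epsilon> :: real assume "\<epsilon> > 0"
  note X = assms(1) and T = assms(7)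
  note s = b_metric_spaceD(1)[OF X] and tri = b_metric_spaceD(4)[OF X]
  note TX = weak_quasi_contractionD[OF T]
  have EX: "E \<subseteq> X" using assms(4) unfolding b_closed_def by simp
  \<comment> \<open>Two distances of size \<open>\<epsilon>'\<close> are added below, and one
    b-triangle inequality multiplies the sum by \<open>s\<close>.\<close>
  define \<epsilon>' where "\<epsilon>' = \<epsilon> / (2 * s)"
  have \<epsilon>': "\<epsilon>' > 0" using \<open>\<epsilon> > 0\<close> s by (simp add: \<epsilon>'_def)
  obtain n where n: "\<And>f x. f \<in> F \<Longrightarrow> x \<in> X \<Longrightarrow> b_setdist d (seq_comp T f n x) E < \<epsilon>'"
    using assms(10)[OF \<epsilon>'] by blast
  \<comment> \<open>Chosen so that the accumulated error \<open>(2 * s) ^ n * \<eta>\<close> is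
    exactly \<open>\<epsilon>'\<close>.\<close>
  define \<eta> where "\<eta> = \<epsilon>' / (2 * s) ^ n"
  have \<eta>: "\<eta> > 0" using \<epsilon>' s by (simp add: \<eta>_def)
  obtain K where K: "\<And>k. k \<ge> K \<Longrightarrow> \<delta> k < \<eta>"
    using order_tendstoD(2)[OF assms(12) \<eta>] unfolding eventually_sequentially by blast
  show "\<exists>N\<ge>1. \<forall>f\<in>F. \<forall>x. (\<forall>i. x i \<in> X) \<and>
      (\<forall>i j. b_diam d (orb2 (T (f j)) (x (i + 1)) (T (f i) (x i))) \<le> \<delta> i)
      \<longrightarrow> (\<forall>i\<ge>N. b_setdist d (x i) E < \<epsilon>)"
  proof (intro exI[of _ "Suc K + Suc n"] conjI ballI allI impI; (elim conjE)?)
    fix f x i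
    assume f: "f \<in> F" and x: "\<forall>i. x i \<in> X"
      and err: "\<forall>i j. b_diam d (orb2 (T (f j)) (x (i + 1)) (T (f i) (x i))) \<le> \<delta> i"
      and i: "Suc K + Suc n \<le> i"
    \<comment> \<open>The restart index: \<open>seq_comp T g n\<close> applies \<open>Suc n\<close>
      maps, so the exact iterate from \<open>x p\<close> is compared with \<open>x i\<close>. The
      bound on \<open>i\<close> gives \<open>p\<close> at least \<open>Suc K\<close>, so every later
      error is below \<open>\<eta>\<close> and the shift is positive.\<close>
    define p where "p = i - Suc n"
    have p: "p \<ge> 1" "p \<ge> K" and ip: "i = Suc n + p" using i by (auto simp: p_def)
    define g where "g = (\<lambda>k. f (k + p))"
    have g: "g \<in> F" using assms(6) f p unfolding shift_property_def g_def by blast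
    let ?y = "seq_comp T g n (x p)"
    have y: "?y \<in> X" using TX x by (intro seq_comp_in_carrier) blast+
    \<comment> \<open>The index 0 in \<open>g 0\<close> is arbitrary, since any joint orbit contains
      both points. The term \<open>0 + p\<close> is left unsimplified to match the shifted sequence
      \<open>x (k + p)\<close> at \<open>k = 0\<close>.\<close>
    have "b_diam d (orb2 (T (g 0)) (x (Suc n + p)) (seq_comp T g n (x (0 + p)))) \<le> (2 * s) ^ n * \<eta>"
    proof (rule b_diam_orb2_inexact_le[OF X T, where x = "\<lambda>k. x (k + p)"])
      show "b_diam d (orb2 (T (g j)) (x (Suc k + p)) (T (g k) (x (k + p)))) \<le> \<eta>" for k j
        using err[rule_format, of "j + p" "k + p"] K[of "k + p"] p by (simp add: g_def)
    qed (use assms(9)[OF _ _ g] x \<eta> in auto)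
    also have "\<dots> = \<epsilon>'" using s by (simp add: \<eta>_def)
    finally have "b_diam d (orb2 (T (g 0)) (x i) ?y) \<le> \<epsilon>'" by (simp add: ip)
    moreover have "d (x i) ?y \<le> b_diam d (orb2 (T (g 0)) (x i) ?y)"
      using x y by (intro dist_le_b_diam weak_quasi_contraction_bounded_orb2[OF X T])
        (auto simp: orb2_def orb_self)
    moreover obtain e where e: "e \<in> E" "d ?y e < \<epsilon>'"
      using b_setdist_lessE[OF n[OF g] assms(3)] x by blast
    \<comment> \<open>The first distance is only at most \<open>\<epsilon>'\<close>; strictness
      comes from the choice of \<open>e\<close>.\<close>
    ultimately have close: "d (x i) ?y + d ?y e < 2 * \<epsilon>'" by linarith
    have "b_setdist d (x i) E \<le> d (x i) e"
      using b_setdist_le[OF X EX] x e by blast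
    also have "\<dots> \<le> s * (d (x i) ?y + d ?y e)"
      using tri x y e EX by blast
    also have "\<dots> < s * (2 * \<epsilon>')"
      using close s by simp
    also have "\<dots> = \<epsilon>" using s by (simp add: \<epsilon>'_def)
    finally show "b_setdist d (x i) E < \<epsilon>" .
  qed simp
qed

end
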